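(* Let $f_1,f_2\in C^2(\mathbb{R})$ and suppose that there are constants $C_1,C_2>0$ and exponents $\mu_1,\mu_2>1$ such that for $i=1,2$ $$0<f_i''(t)\le C_i(1+t^2)^{-\mu_i/2}\quad\text{for all } t\in\mathbb{R}.$$ Let $f(p_1,p_2):=f_1(p_1)+f_2(p_2)$ for $(p_1,p_2)\in\mathbb{R}^2$, and let $u\in C^2(\mathbb{R}^2)$ be a solution of $$\operatorname{div}\big(Df(\nabla u)\big)=0\quad\text{on } \mathbb{R}^2 .$$ Then $u$ is an affine function or $u$ is unbalanced.
   Context: The equation $\operatorname{div}(Df(\nabla u))=0$ reads $f_1''(\partial_1u)\,\partial_{11}u+f_2''(\partial_2u)\,\partial_{22}u=0$. Definition. A function $u\in C^1(\mathbb{R}^2)$, $u=u(x_1,x_2)$, is called unbalanced if and only if both of the following conditions hold: $$\limsup_{|x|\to\infty}\frac{|\partial_1u(x)|}{1+|\partial_2u(x)|}=\infty,\qquad \limsup_{|x|\to\infty}\frac{|\partial_2u(x)|}{1+|\partial_1u(x)|}=\infty .$$ The first condition, for example, means that there is a sequence of points $x_n\in\mathbb{R}^2$ with $|x_n|\to\infty$ and $\lim_{n\to\infty}\frac{|\partial_1u(x_n)|}{1+|\partial_2u(x_n)|}=\infty$; the second is understood analogously. *)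

theory Defs
  imports "HOL-Analysis.Analysis"
begin

definition partial_deriv :: "'n \<Rightarrow> (real ^ 'n \<Rightarrow> real) \<Rightarrow> real ^ 'n \<Rightarrow> real" where
  "partial_deriv i u x = deriv (\<lambda>t. u (x + t *\<^sub>R axis i 1)) 0"

definition gradient :: "(real ^ 'n \<Rightarrow> real) \<Rightarrow> real ^ 'n \<Rightarrow> real ^ 'n" where
  "gradient u x = (\<chi> i. partial_deriv i u x)"

definition divergence :: "(real ^ 'n \<Rightarrow> real ^ 'n) \<Rightarrow> real ^ 'n \<Rightarrow> real" where
  "divergence F x = (\<Sum>i\<in>UNIV. partial_deriv i (\<lambda>y. F y $ i) x)"

(* Differentiability is required explicitly because deriv is total. *)
definition C1_space :: "(real ^ 'n \<Rightarrow> real) \<Rightarrow> bool" where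
  "C1_space u \<longleftrightarrow> (\<forall>x. u differentiable (at x)) \<and>
     (\<forall>i. continuous_on UNIV (partial_deriv i u))"

definition C2_space :: "(real ^ 'n \<Rightarrow> real) \<Rightarrow> bool" where
  "C2_space u \<longleftrightarrow> C1_space u \<and> (\<forall>i. C1_space (partial_deriv i u))"

definition C2_line :: "(real \<Rightarrow> real) \<Rightarrow> bool" where
  "C2_line f \<longleftrightarrow> f C1_differentiable_on UNIV \<and> deriv f C1_differentiable_on UNIV"

definition unbalanced :: "(real ^ 2 \<Rightarrow> real) \<Rightarrow> bool" where
  "unbalanced u \<longleftrightarrow> C1_space u \<and>
     Limsup at_infinity
       (\<lambda>x. ereal (\<bar>partial_deriv 1 u x\<bar> / (1 + \<bar>partial_deriv 2 u x\<bar>))) = \<infinity> \<and>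
     Limsup at_infinity
       (\<lambda>x. ereal (\<bar>partial_deriv 2 u x\<bar> / (1 + \<bar>partial_deriv 1 u x\<bar>))) = \<infinity>"

definition affine_function :: "(real ^ 'n \<Rightarrow> real) \<Rightarrow> bool" where
  "affine_function u \<longleftrightarrow> (\<exists>a b. \<forall>x. u x = a \<bullet> x + b)"

end

theory Submission imports Defs begin

text \<open>Write $a_i = f_i''(\partial_i u)$. If one of the two limits superior is finite, then after
  exchanging the variables $|\partial_1 u| \le C (1 + |\partial_2 u|)$ on the whole plane, so both
  $a_1$ and $a_2$ are bounded by a multiple of $(1 + (\partial_1 u)^2)^{-\mu/2}$ with
  $\mu = \min(\mu_1, \mu_2) > 1$. Differentiate the equation in $x_1$ and test it with
  $\zeta\, G(\partial_1 u)$, where $G(t) = t (1 + t^2)^{\mu/2 - 1}$: since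
  $G^2 \le (1 + t^2)^{\mu/2} G' / (\mu - 1)$, this bounds the integral of
  $\zeta\, G'(\partial_1 u) (a_1 (\partial_{11} u)^2 + a_2 (\partial_{12} u)^2)$ by the
  Dirichlet energy of $\sqrt\zeta$. For logarithmic cutoffs this energy tends to zero, so all
  second derivatives of $u$ vanish. Third derivatives of $u$ are avoided by using the identity
  $\int d\varphi \wedge dB = 0$, for $\varphi$ of class $C^1$ with compact support and
  $B = f_2'(\partial_2 u)$ only of class $C^1$.\<close>

section \<open>Continuously differentiable functions on the plane\<close>

text \<open>The partial derivatives are arguments, so a concrete formula for them can be carried
  along by the product and chain rules and differentiated again. Pairs of reals are used because
  integrals over a rectangle in \<open>real \<times> real\<close> split into iterated ones.\<close>

definition C1_plane :: "(real \<times> real \<Rightarrow> real) \<Rightarrow> (real \<times> real \<Rightarrow> real) \<Rightarrow> (real \<times> real \<Rightarrow> real) \<Rightarrow> bool"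
  where "C1_plane f fx fy \<longleftrightarrow>
    continuous_on UNIV f \<and> continuous_on UNIV fx \<and> continuous_on UNIV fy \<and>
    (\<forall>x y. ((\<lambda>s. f (s, y)) has_real_derivative fx (x, y)) (at x)) \<and>
    (\<forall>x y. ((\<lambda>t. f (x, t)) has_real_derivative fy (x, y)) (at y))"

lemma C1_planeD:
  assumes "C1_plane f fx fy"
  shows "continuous_on UNIV f" "continuous_on UNIV fx" "continuous_on UNIV fy"
    "((\<lambda>s. f (s, y)) has_real_derivative fx (x, y)) (at x)"
    "((\<lambda>t. f (x, t)) has_real_derivative fy (x, y)) (at y)"
  using assms by (auto simp: C1_plane_def)

lemma C1_plane_continuous_on:
  assumes "C1_plane f fx fy" "continuous_on A g"
  shows "continuous_on A (\<lambda>w. f (g w))" "continuous_on A (\<lambda>w. fx (g w))"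
    "continuous_on A (\<lambda>w. fy (g w))"
  using assms by (auto simp: C1_plane_def intro: continuous_on_compose2[of UNIV])

lemma C1_plane_swap:
  assumes "C1_plane f fx fy"
  shows "C1_plane (\<lambda>z. f (snd z, fst z)) (\<lambda>z. fy (snd z, fst z)) (\<lambda>z. fx (snd z, fst z))"
  unfolding C1_plane_def
  using C1_planeD(4,5)[OF assms]
  by (auto intro!: C1_plane_continuous_on[OF assms] continuous_intros)

lemma C1_plane_mult:
  assumes f: "C1_plane f fx fy" and g: "C1_plane g gx gy"
  shows "C1_plane (\<lambda>z. f z * g z) (\<lambda>z. fx z * g z + f z * gx z) (\<lambda>z. fy z * g z + f z * gy z)"
  using C1_planeD[OF f] C1_planeD[OF g] unfolding C1_plane_def
  by (auto intro!: continuous_intros derivative_eq_intros)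

lemma C1_plane_compose:
  assumes F: "\<And>t. (F has_real_derivative F' t) (at t)" and F': "continuous_on UNIV F'"
    and f: "C1_plane f fx fy"
  shows "C1_plane (\<lambda>z. F (f z)) (\<lambda>z. F' (f z) * fx z) (\<lambda>z. F' (f z) * fy z)"
proof -
  have "continuous_on UNIV F"
    using F by (meson DERIV_isCont continuous_at_imp_continuous_on)
  then show ?thesis
    using C1_planeD[OF f] unfolding C1_plane_def
    by (auto intro!: continuous_on_mult continuous_on_compose2[OF F'] continuous_on_compose2[of UNIV F]
        DERIV_chain2[OF F])
qed

section \<open>Integration by parts, mixed derivatives and the wedge identity\<close>

lemma integral_parts_vanishing:
  fixes f g f' g' :: "real \<Rightarrow> real"
  assumes "a \<le> b" "\<And>x. (f has_real_derivative f' x) (at x)" "\<And>x. (g has_real_derivative g' x) (at x)"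
    and "continuous_on UNIV f'" "continuous_on UNIV g'" "f a = 0" "f b = 0"
  shows "integral {a..b} (\<lambda>x. f' x * g x) = - integral {a..b} (\<lambda>x. f x * g' x)"
proof -
  have cf: "continuous_on {a..b} f" and cg: "continuous_on {a..b} g"
    using assms(2,3) by (meson DERIV_isCont continuous_at_imp_continuous_on)+
  have "((\<lambda>x. f x * g' x) has_integral integral {a..b} (\<lambda>x. f x * g' x)) {a..b}"
    by (intro integrable_integral integrable_continuous_real continuous_intros cf
        continuous_on_subset[OF assms(5)]) auto
  then have "((\<lambda>x. f x * g' x) has_integral
      f b * g b - f a * g a - (- integral {a..b} (\<lambda>x. f x * g' x))) {a..b}"
    using assms by simp
  then have "((\<lambda>x. f' x * g x) has_integral (- integral {a..b} (\<lambda>x. f x * g' x))) {a..b}"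
    by (intro integration_by_parts[OF bounded_bilinear_mult assms(1) cf cg])
      (use assms(2,3) has_real_derivative_iff_has_vector_derivative in auto)
  then show ?thesis by (rule integral_unique)
qed

text \<open>Apply $\partial_y$ to $u(s, y) = u(a, y) + \int_a^s u_x(r, y)\, dr$ under the integral sign, then
  $\partial_s$.\<close>
lemma mixed_partials_commute:
  assumes u: "C1_plane u p q" and p: "C1_plane p p1 p2" and q: "C1_plane q q1 q2"
  shows "q1 = p2"
proof
  fix z :: "real \<times> real"
  obtain x y where z: "z = (x, y)" by force
  \<comment> \<open>The fixed lower limit lies strictly left of x. Hence x is interior to
    \<open>{a..x+1}\<close>, and the derivative within that interval found below is a two-sided
    one.\<close>
  define a where "a = x - 1"
  have eq: "u (s, t) = u (a, t) + integral (cbox a s) (\<lambda>r. p (r, t))" if "a \<le> s" for s t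
  proof -
    have "((\<lambda>r. p (r, t)) has_integral u (s, t) - u (a, t)) {a..s}"
      using that C1_planeD(4)[OF u]
      by (intro fundamental_theorem_of_calculus)
        (auto simp flip: has_real_derivative_iff_has_vector_derivative intro: DERIV_subset)
    then show ?thesis by (simp add: integral_unique)
  qed
  have q_eq: "q (s, y) = q (a, y) + integral (cbox a s) (\<lambda>r. p2 (r, y))" if "a \<le> s" for s
  proof -
    have "((\<lambda>t. integral (cbox a s) (\<lambda>r. p (r, t))) has_field_derivative
        integral (cbox a s) (\<lambda>r. p2 (r, y))) (at y within UNIV)"
      by (rule leibniz_rule_field_derivative)
        (auto simp: split_beta intro!: C1_planeD[OF p] integrable_continuous_real continuous_intros
          C1_plane_continuous_on[OF p])
    then have "((\<lambda>t. u (a, t) + integral (cbox a s) (\<lambda>r. p (r, t))) has_field_derivative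
        q (a, y) + integral (cbox a s) (\<lambda>r. p2 (r, y))) (at y)"
      by (intro DERIV_add C1_planeD[OF u]) simp
    then have "((\<lambda>t. u (s, t)) has_field_derivative
        q (a, y) + integral (cbox a s) (\<lambda>r. p2 (r, y))) (at y)"
      using eq[OF that] by simp
    then show ?thesis using C1_planeD(5)[OF u] DERIV_unique by blast
  qed
  have "((\<lambda>s. integral {a..s} (\<lambda>r. p2 (r, y))) has_real_derivative p2 (x, y)) (at x within {a..x+1})"
    by (rule integral_has_real_derivative)
      (auto simp: a_def intro!: continuous_intros C1_plane_continuous_on[OF p])
  then have "((\<lambda>s. q (a, y) + integral {a..s} (\<lambda>r. p2 (r, y))) has_real_derivative p2 (x, y)) (at x within {a..x+1})"
    by (auto intro!: derivative_eq_intros)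
  then have "((\<lambda>s. q (s, y)) has_real_derivative p2 (x, y)) (at x within {a..x+1})"
  proof (rule has_field_derivative_transform_within[OF _ zero_less_one])
    show "q (a, y) + integral {a..s} (\<lambda>r. p2 (r, y)) = q (s, y)" if "s \<in> {a..x+1}" for s
      using q_eq[of s] that by simp
  qed (simp add: a_def)
  then have "((\<lambda>s. q (s, y)) has_real_derivative p2 (x, y)) (at x)"
    by (subst (asm) at_within_Icc_at) (auto simp: a_def)
  then show "q1 z = p2 z"
    using C1_planeD(4)[OF q] DERIV_unique z by blast
qed

lemma integral_swap_continuous_Icc:
  fixes F :: "real \<times> real \<Rightarrow> real"
  assumes "continuous_on UNIV F"
  shows "integral {a..b} (\<lambda>x. integral {c..d} (\<lambda>y. F (x, y))) =
    integral {c..d} (\<lambda>y. integral {a..b} (\<lambda>x. F (x, y)))"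
  using integral_swap_continuous[of a c b d "\<lambda>x y. F (x, y)"] continuous_on_subset[OF assms]
  by simp

text \<open>Differentiating $\int f_x(x, y) B(x, y + h) = - \int f(x, y - h) B_x(x, y)$ at $h = 0$ replaces
  the second derivatives of $B$, which need not exist.\<close>
lemma integral_wedge_vanishing:
  assumes f: "C1_plane f f1 f2" and B: "C1_plane B B1 B2"
    and supp: "\<And>x y. R \<le> \<bar>x\<bar> \<or> R \<le> \<bar>y\<bar> \<Longrightarrow> f (x, y) = 0" and S: "R + 1 \<le> S" "0 \<le> S"
  shows "integral (cbox (-S, -S) (S, S)) (\<lambda>z. f1 z * B2 z - f2 z * B1 z) = 0"
proof -
  let ?Q = "cbox (-S, -S) (S, S) :: (real \<times> real) set"
  note ci = continuous_intros C1_plane_continuous_on[OF f] C1_plane_continuous_on[OF B]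
  define J where "J h = integral ?Q (\<lambda>z. f1 z * B (fst z, snd z + h))" for h
  define K where "K h = - integral ?Q (\<lambda>z. f (fst z, snd z - h) * B1 z)" for h
  have J': "(J has_field_derivative integral ?Q (\<lambda>z. f1 z * B2 (fst z, snd z + 0))) (at 0 within UNIV)"
    unfolding J_def
  proof (rule leibniz_rule_field_derivative)
    fix h and z :: "real \<times> real"
    have "((\<lambda>h. B (fst z, snd z + h)) has_real_derivative B2 (fst z, snd z + h) * (0 + 1)) (at h)"
      by (rule DERIV_chain2[OF C1_planeD(5)[OF B]]) (auto intro!: derivative_eq_intros)
    then show "((\<lambda>h. f1 z * B (fst z, snd z + h)) has_real_derivative f1 z * B2 (fst z, snd z + h)) (at h)"
      by (auto intro!: derivative_eq_intros)
  qed (auto simp: split_beta intro!: integrable_continuous ci)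
  have "((\<lambda>h. integral ?Q (\<lambda>z. f (fst z, snd z - h) * B1 z)) has_field_derivative
      integral ?Q (\<lambda>z. - f2 (fst z, snd z - 0) * B1 z)) (at 0 within UNIV)"
  proof (rule leibniz_rule_field_derivative)
    fix h and z :: "real \<times> real"
    have "((\<lambda>h. f (fst z, snd z - h)) has_real_derivative f2 (fst z, snd z - h) * (0 - 1)) (at h)"
      by (rule DERIV_chain2[OF C1_planeD(5)[OF f]]) (auto intro!: derivative_eq_intros)
    then show "((\<lambda>h. f (fst z, snd z - h) * B1 z) has_real_derivative - f2 (fst z, snd z - h) * B1 z) (at h)"
      by (auto intro!: derivative_eq_intros)
  qed (auto simp: split_beta intro!: integrable_continuous ci)
  then have K': "(K has_field_derivative integral ?Q (\<lambda>z. f2 z * B1 z)) (at 0)"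
    unfolding K_def by (auto intro!: derivative_eq_intros)
  \<comment> \<open>Integrate by parts in the first variable for fixed y, where the boundary terms
    vanish by the support condition, then exchange the order of integration and translate the second
    variable by h.\<close>
  have "J h = K h" if h: "\<bar>h\<bar> < 1" for h
  proof -
    have "J h = integral {-S..S} (\<lambda>x. integral {-S..S} (\<lambda>y. f1 (x, y) * B (x, y + h)))"
      unfolding J_def by (subst integral_prod_continuous) (auto intro!: ci)
    also have "\<dots> = integral {-S..S} (\<lambda>y. integral {-S..S} (\<lambda>x. f1 (x, y) * B (x, y + h)))"
    proof -
      have "continuous_on UNIV (\<lambda>z. f1 z * B (fst z, snd z + h))" by (intro ci)
      from integral_swap_continuous_Icc[OF this, of "-S" S "-S" S] show ?thesis by simp
    qed
    also have "\<dots> = integral {-S..S} (\<lambda>y. - integral {-S..S} (\<lambda>x. f (x, y) * B1 (x, y + h)))"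
    proof (rule integral_cong)
      fix y
      show "integral {-S..S} (\<lambda>x. f1 (x, y) * B (x, y + h)) =
        - integral {-S..S} (\<lambda>x. f (x, y) * B1 (x, y + h))"
        by (rule integral_parts_vanishing)
          (use S in \<open>auto intro!: C1_planeD[OF f] C1_planeD[OF B] ci supp\<close>)
    qed
    also have "\<dots> = - integral {-S..S} (\<lambda>y. integral {-S..S} (\<lambda>x. f (x, y) * B1 (x, y + h)))"
      by simp
    also have "\<dots> = - integral {-S..S} (\<lambda>x. integral {-S..S} (\<lambda>y. f (x, y) * B1 (x, y + h)))"
    proof -
      have "continuous_on UNIV (\<lambda>z. f z * B1 (fst z, snd z + h))" by (intro ci)
      from integral_swap_continuous_Icc[OF this, of "-S" S "-S" S] show ?thesis by simp
    qed
    also have "\<dots> = - integral {-S..S} (\<lambda>x. integral {-S..S} (\<lambda>y. f (x, y - h) * B1 (x, y)))"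
    proof -
      have "integral {-S..S} (\<lambda>y. f (x, y) * B1 (x, y + h)) =
        integral {-S..S} (\<lambda>y. f (x, y - h) * B1 (x, y))" for x
      proof -
        let ?g = "\<lambda>y. f (x, y - h) * B1 (x, y)"
        have "integral {-S..S} (\<lambda>y. f (x, y) * B1 (x, y + h)) = integral {-S..S} (?g \<circ> (\<lambda>y. y + h))"
          by (simp add: o_def)
        also have "\<dots> = integral {-S+h..S+h} ?g"
          using integral_shift_Icc_real[of "-S" S ?g h] by (simp add: o_def add.commute)
        also have "\<dots> = integral UNIV (\<lambda>y. if y \<in> {-S+h..S+h} then ?g y else 0)"
          by (rule integral_restrict_UNIV[symmetric])
        \<comment> \<open>The translated interval may be replaced by the original one: where exactly
          one of them contains y, either |y| > S or |y - h| > S. Since |h| < 1 and S is at least R +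
          1, in both cases |y - h| is at least R and the factor f vanishes.\<close>
        also have "\<dots> = integral UNIV (\<lambda>y. if y \<in> {-S..S} then ?g y else 0)"
          by (rule arg_cong[where f = "integral UNIV"]) (use h S supp in force)
        also have "\<dots> = integral {-S..S} ?g"
          by (rule integral_restrict_UNIV)
        finally show ?thesis .
      qed
      then show ?thesis by simp
    qed
    also have "\<dots> = K h"
      unfolding K_def by (subst integral_prod_continuous) (auto intro!: ci)
    finally show ?thesis .
  qed
  then have "\<forall>\<^sub>F h in nhds 0. J h = K h"
    unfolding eventually_nhds_metric by (intro exI[of _ 1]) (auto simp: dist_real_def)
  then have "(J has_field_derivative integral ?Q (\<lambda>z. f2 z * B1 z)) (at 0)"
    using K' DERIV_cong_ev[of 0 0 J K] by blast
  then have "integral ?Q (\<lambda>z. f1 z * B2 z) = integral ?Q (\<lambda>z. f2 z * B1 z)"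
    using J' DERIV_unique by fastforce
  then show ?thesis
    by (subst integral_diff) (auto intro!: integrable_continuous ci)
qed

section \<open>Logarithmic cutoff functions\<close>

text \<open>Squaring removes the kink of the positive part: 0 and the square of t agree at 0
  together with their derivatives. This makes the cutoff continuously differentiable.\<close>

lemma has_real_derivative_max_0_squared:
  "((\<lambda>t. (max 0 t)\<^sup>2) has_real_derivative 2 * max 0 t) (at (t::real))"
proof -
  have "((\<lambda>t::real. if t \<in> {..0} then 0 else t\<^sup>2) has_derivative
      (if t \<in> {..0} then (\<lambda>x h. 0) t else (\<lambda>x h. 2 * x * h) t)) (at t within {..0} \<union> {0..})"
    by (rule has_derivative_If_within_closures) (auto intro!: derivative_eq_intros)
  moreover have "{..0} \<union> {0..} = (UNIV :: real set)"
    by auto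
  moreover have "(\<lambda>t::real. if t \<in> {..0} then 0 else t\<^sup>2) = (\<lambda>t. (max 0 t)\<^sup>2)"
    by (auto simp: fun_eq_iff)
  moreover have "(if t \<in> {..0} then (\<lambda>x h. 0) t else (\<lambda>x h. 2 * x * h) t) = (*) (2 * max 0 t)"
    by (auto simp: fun_eq_iff)
  ultimately show ?thesis by (simp only: has_field_derivative_def)
qed

text \<open>The cutoff function is the square of the positive part of \<open>cutoff_root L\<close>.\<close>
definition cutoff_root :: "real \<Rightarrow> real \<times> real \<Rightarrow> real"
  where "cutoff_root L z = 1 - ln (1 + (fst z)\<^sup>2 + (snd z)\<^sup>2) / L"

lemma one_plus_squares_pos: "0 < 1 + (x::real)\<^sup>2 + y\<^sup>2"
  by (simp add: add_pos_nonneg)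

lemma C1_plane_cutoff_root:
  assumes "L \<noteq> 0"
  shows "C1_plane (cutoff_root L)
    (\<lambda>z. - (2 * fst z / (L * (1 + (fst z)\<^sup>2 + (snd z)\<^sup>2))))
    (\<lambda>z. - (2 * snd z / (L * (1 + (fst z)\<^sup>2 + (snd z)\<^sup>2))))"
proof -
  note ne = one_plus_squares_pos[THEN less_imp_neq, symmetric]
  have "((\<lambda>s. 1 - ln (1 + s\<^sup>2 + y\<^sup>2) / L) has_real_derivative - (2 * x / (L * (1 + x\<^sup>2 + y\<^sup>2)))) (at x)" for x y
    by (rule derivative_eq_intros refl one_plus_squares_pos | simp add: assms)+
  moreover have "((\<lambda>t. 1 - ln (1 + x\<^sup>2 + t\<^sup>2) / L) has_real_derivative - (2 * y / (L * (1 + x\<^sup>2 + y\<^sup>2)))) (at y)" for x y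
    by (rule derivative_eq_intros refl one_plus_squares_pos | simp add: assms)+
  moreover have "L * (1 + (fst z)\<^sup>2 + (snd z)\<^sup>2) \<noteq> 0" for z :: "real \<times> real"
    using assms ne by simp
  ultimately show ?thesis
    unfolding C1_plane_def cutoff_root_def fst_conv snd_conv
    using assms ne by (intro conjI allI continuous_intros ballI) auto
qed

lemma C1_plane_cutoff:
  assumes "L \<noteq> 0"
  shows "C1_plane (\<lambda>z. (max 0 (cutoff_root L z))\<^sup>2)
    (\<lambda>z. 2 * max 0 (cutoff_root L z) * - (2 * fst z / (L * (1 + (fst z)\<^sup>2 + (snd z)\<^sup>2))))
    (\<lambda>z. 2 * max 0 (cutoff_root L z) * - (2 * snd z / (L * (1 + (fst z)\<^sup>2 + (snd z)\<^sup>2))))"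
  by (rule C1_plane_compose[OF has_real_derivative_max_0_squared _ C1_plane_cutoff_root[OF assms]])
    (intro continuous_intros)

text \<open>The root is nonpositive once 1 + |(x, y)|^2 is at least exp L. Outside the square of
  half-side exp L even (exp L)^2 is reached, so the cutoff is supported in that square.\<close>

lemma cutoff_root_nonpos:
  assumes "L > 0" "exp L \<le> \<bar>x\<bar> \<or> exp L \<le> \<bar>y\<bar>"
  shows "cutoff_root L (x, y) \<le> 0"
proof -
  have "1 \<le> exp L" using assms(1) by simp
  then have "exp L \<le> (exp L)\<^sup>2" by (simp add: power2_eq_square)
  also have "\<dots> \<le> 1 + x\<^sup>2 + y\<^sup>2"
    using assms(2)
  proof
    assume "exp L \<le> \<bar>x\<bar>"
    then have "(exp L)\<^sup>2 \<le> x\<^sup>2" using power_mono[of "exp L" "\<bar>x\<bar>" 2] by simp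
    then show ?thesis by (smt (verit) zero_le_power2)
  next
    assume "exp L \<le> \<bar>y\<bar>"
    then have "(exp L)\<^sup>2 \<le> y\<^sup>2" using power_mono[of "exp L" "\<bar>y\<bar>" 2] by simp
    then show ?thesis by (smt (verit) zero_le_power2)
  qed
  finally have "L \<le> ln (1 + x\<^sup>2 + y\<^sup>2)" using one_plus_squares_pos ln_ge_iff by blast
  then show ?thesis using assms(1) by (simp add: cutoff_root_def field_simps)
qed

text \<open>The inner integral is an explicit arctangent, at most \<pi> / sqrt (x^2 + 1), and this
  bound has antiderivative \<pi> arsinh x. The integral therefore grows only logarithmically in S,
  which is special to dimension two.\<close>

lemma integral_inverse_one_plus_squares_le:
  assumes "0 \<le> S"
  shows "integral (cbox (-S, -S) (S, S)) (\<lambda>z. 1 / (1 + (fst z)\<^sup>2 + (snd z)\<^sup>2)) \<le> 2 * pi * arsinh S"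
proof -
  note ne = one_plus_squares_pos[THEN less_imp_neq, symmetric]
  have cont: "continuous_on UNIV (\<lambda>z::real \<times> real. 1 / (1 + (fst z)\<^sup>2 + (snd z)\<^sup>2))"
    using ne by (auto intro!: continuous_intros)
  have inner: "integral {-S..S} (\<lambda>y. 1 / (1 + x\<^sup>2 + y\<^sup>2)) \<le> pi * (1 / sqrt (x\<^sup>2 + 1))" for x
  proof -
    let ?c = "sqrt (x\<^sup>2 + 1)"
    have c: "0 < ?c" "?c\<^sup>2 = x\<^sup>2 + 1" by (auto simp: add_nonneg_pos)
    have "((\<lambda>y. arctan (y / ?c) / ?c) has_real_derivative 1 / (1 + x\<^sup>2 + y\<^sup>2)) (at y)" for y
    proof -
      have "((\<lambda>y. arctan (y / ?c) / ?c) has_real_derivative (1 / (1 + (y / ?c)\<^sup>2)) * (1 / ?c) / ?c) (at y)"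
        using c(1) by (auto intro!: derivative_eq_intros simp: inverse_eq_divide)
      moreover have "(1 / (1 + (y / ?c)\<^sup>2)) * (1 / ?c) / ?c = 1 / (?c\<^sup>2 * (1 + (y / ?c)\<^sup>2))"
        by (simp add: power2_eq_square)
      moreover have "?c\<^sup>2 * (1 + (y / ?c)\<^sup>2) = 1 + x\<^sup>2 + y\<^sup>2"
      proof -
        have "?c\<^sup>2 * (1 + (y / ?c)\<^sup>2) = ?c\<^sup>2 + y\<^sup>2"
          using c(1) by (simp only: power_divide distrib_left) simp
        then show ?thesis using c(2) by simp
      qed
      ultimately show ?thesis by metis
    qed
    then have "((\<lambda>y. 1 / (1 + x\<^sup>2 + y\<^sup>2)) has_integral arctan (S / ?c) / ?c - arctan (-S / ?c) / ?c) {-S..S}"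
      using assms
      by (intro fundamental_theorem_of_calculus)
        (auto simp flip: has_real_derivative_iff_has_vector_derivative intro: DERIV_subset)
    then have "integral {-S..S} (\<lambda>y. 1 / (1 + x\<^sup>2 + y\<^sup>2)) = 2 * arctan (S / ?c) / ?c"
      by (simp add: integral_unique arctan_minus)
    also have "\<dots> \<le> pi / ?c"
      using c(1) arctan_ubound[of "S / ?c"] by (intro divide_right_mono) auto
    finally show ?thesis by simp
  qed
  have "((\<lambda>x. 1 / sqrt (x\<^sup>2 + 1)) has_integral arsinh S - arsinh (-S)) {-S..S}" (is "(?h has_integral _) _")
    using assms
    by (intro fundamental_theorem_of_calculus)
      (auto simp flip: has_real_derivative_iff_has_vector_derivative intro: arsinh_real_has_field_derivative)
  then have outer: "((\<lambda>x. pi * (1 / sqrt (x\<^sup>2 + 1))) has_integral pi * (2 * arsinh S)) {-S..S}"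
    using has_integral_mult_right[of ?h "arsinh S - arsinh (-S)" _ pi] by simp
  have "continuous_on {-S..S} (\<lambda>x. integral (cbox (-S) S) (\<lambda>y. 1 / (1 + x\<^sup>2 + y\<^sup>2)))"
    by (rule integral_continuous_on_param) (use ne in \<open>auto simp: split_beta intro!: continuous_intros\<close>)
  then have "(\<lambda>x. integral {-S..S} (\<lambda>y. 1 / (1 + x\<^sup>2 + y\<^sup>2))) integrable_on {-S..S}"
    by (auto intro: integrable_continuous_real)
  then have "integral {-S..S} (\<lambda>x. integral {-S..S} (\<lambda>y. 1 / (1 + x\<^sup>2 + y\<^sup>2))) \<le> pi * (2 * arsinh S)"
    using has_integral_le[OF integrable_integral outer] inner by blast
  then show ?thesis
    by (subst integral_prod_continuous) (auto intro: continuous_on_subset[OF cont])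
qed

text \<open>Up to a constant factor this quotient bounds the Dirichlet energy of the root of the
  cutoff: the numerator grows linearly in L, while the squared gradient contributes 1 / L^2.\<close>

lemma tendsto_arsinh_exp_over_square: "((\<lambda>L. arsinh (exp L + 1) / L\<^sup>2) \<longlongrightarrow> 0) (at_top :: real filter)"
proof (rule tendsto_sandwich[of "\<lambda>_. 0" _ _ "\<lambda>L. 6 / L"])
  show "\<forall>\<^sub>F L in at_top. arsinh (exp L + 1) / L\<^sup>2 \<le> 6 / (L::real)"
    using eventually_ge_at_top[of 1]
  proof eventually_elim
    case (elim L)
    \<comment> \<open>As exp L is at least 1, the argument of the logarithm in
      \<open>arsinh ?x\<close> is at most 2 exp L + 3, hence at most 6 exp L. Then ln 6 is at most
      5, which is at most 5 L.\<close>
    let ?x = "exp L + 1"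
    have e: "1 \<le> exp L" using elim by simp
    have "?x\<^sup>2 + 1 \<le> (?x + 1)\<^sup>2"
      using e by (simp add: power2_eq_square algebra_simps)
    then have r: "sqrt (?x\<^sup>2 + 1) \<le> ?x + 1"
      using e by (intro real_le_lsqrt) auto
    have "0 \<le> sqrt (?x\<^sup>2 + 1)" by simp
    then have "0 < ?x + sqrt (?x\<^sup>2 + 1)" "?x + sqrt (?x\<^sup>2 + 1) \<le> 6 * exp L"
      using r e by linarith+
    then have "arsinh ?x \<le> ln (6 * exp L)"
      unfolding arsinh_real_def by (subst ln_le_cancel_iff) auto
    also have "\<dots> = ln 6 + L" by (simp add: ln_mult)
    also have "ln (6::real) \<le> 5" using ln_add_one_self_le_self[of 5] by simp
    finally have "arsinh ?x \<le> 6 * L" using elim by linarith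
    then show ?case using elim by (simp add: power2_eq_square field_simps)
  qed
  show "\<forall>\<^sub>F L in at_top. 0 \<le> arsinh (exp L + 1) / (L::real)\<^sup>2"
  proof (intro always_eventually allI divide_nonneg_nonneg)
    show "0 \<le> arsinh (exp L + 1)" for L :: real
      by (intro less_imp_le) (simp add: add_pos_pos)
  qed simp
  show "((\<lambda>L::real. 6 / L) \<longlongrightarrow> 0) at_top"
    by (rule real_tendsto_divide_at_top[OF tendsto_const filterlim_ident])
qed simp_all

section \<open>The test weight G and its derivative\<close>

text \<open>This is the function G of the proof idea. It grows like |t|^(\<mu> - 1), so that G^2 /
  G' grows like |t|^\<mu>, which is exactly what the decay of the coefficients compensates.\<close>

definition power_weight :: "real \<Rightarrow> real \<Rightarrow> real"
  where "power_weight \<mu> t = t * (1 + t\<^sup>2) powr (\<mu> / 2 - 1)"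

text \<open>The derivative of G is kept in factored form, in which its positivity for \<mu> > 1 can
  be read off.\<close>

definition power_weight_deriv :: "real \<Rightarrow> real \<Rightarrow> real"
  where "power_weight_deriv \<mu> t = (1 + t\<^sup>2) powr (\<mu> / 2 - 2) * (1 + (\<mu> - 1) * t\<^sup>2)"

lemma one_plus_square_pos: "0 < 1 + (t::real)\<^sup>2"
  by (simp add: add_pos_nonneg)

lemma has_real_derivative_power_weight:
  "(power_weight \<mu> has_real_derivative power_weight_deriv \<mu> t) (at t)"
proof -
  have pos: "0 < 1 + t\<^sup>2" by (rule one_plus_square_pos)
  have split: "(1 + t\<^sup>2) powr (\<mu> / 2 - 1) = (1 + t\<^sup>2) powr (\<mu> / 2 - 2) * (1 + t\<^sup>2)"
    using powr_mult_base[of "1 + t\<^sup>2" "\<mu> / 2 - 2"] pos by (simp add: mult.commute)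
  have "((\<lambda>t. (1 + t\<^sup>2) powr (\<mu> / 2 - 1)) has_real_derivative
      (\<mu> / 2 - 1) * (1 + t\<^sup>2) powr (\<mu> / 2 - 1 - 1) * (2 * t)) (at t)"
  proof -
    have "((\<lambda>t. 1 + t\<^sup>2) has_real_derivative 2 * t) (at t)"
      by (auto intro!: derivative_eq_intros)
    from DERIV_fun_powr[OF this pos, of "\<mu> / 2 - 1"] show ?thesis by simp
  qed
  from DERIV_mult[OF DERIV_ident this] have "(power_weight \<mu> has_real_derivative (1 + t\<^sup>2) powr (\<mu> / 2 - 1) +
      t * ((\<mu> / 2 - 1) * (1 + t\<^sup>2) powr (\<mu> / 2 - 2) * (2 * t))) (at t)"
    unfolding power_weight_def[abs_def] by (simp add: mult_ac)
  moreover have "(1 + t\<^sup>2) powr (\<mu> / 2 - 1) + t * ((\<mu> / 2 - 1) * (1 + t\<^sup>2) powr (\<mu> / 2 - 2) * (2 * t))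
      = power_weight_deriv \<mu> t"
    unfolding power_weight_deriv_def split by (simp add: algebra_simps power2_eq_square)
  ultimately show ?thesis by simp
qed

lemma continuous_on_power_weight_deriv: "continuous_on A (power_weight_deriv \<mu>)"
proof -
  have ne: "1 + t\<^sup>2 \<noteq> 0" for t :: real
    using one_plus_square_pos[of t] by linarith
  show ?thesis
    unfolding power_weight_deriv_def[abs_def] by (intro continuous_intros ballI ne)
qed

lemma power_weight_deriv_pos:
  assumes "1 < \<mu>"
  shows "0 < power_weight_deriv \<mu> t"
  unfolding power_weight_deriv_def using assms one_plus_square_pos[of t]
  by (intro mult_pos_pos add_pos_nonneg) auto

text \<open>The right side minus the left side is exactly (1 + t^2)^(\<mu> - 2) / (\<mu> -
  1).\<close>

lemma power_weight_square_le:
  assumes "1 < \<mu>"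
  shows "(power_weight \<mu> t)\<^sup>2 \<le> (1 + t\<^sup>2) powr (\<mu> / 2) * power_weight_deriv \<mu> t / (\<mu> - 1)"
proof -
  have "((1 + t\<^sup>2) powr (\<mu> / 2 - 1))\<^sup>2 = (1 + t\<^sup>2) powr (\<mu> / 2) * (1 + t\<^sup>2) powr (\<mu> / 2 - 2)"
    by (simp add: power2_eq_square flip: powr_add)
  then have "(1 + t\<^sup>2) powr (\<mu> / 2) * power_weight_deriv \<mu> t / (\<mu> - 1) - (power_weight \<mu> t)\<^sup>2
      = ((1 + t\<^sup>2) powr (\<mu> / 2 - 1))\<^sup>2 / (\<mu> - 1)"
    using assms by (simp add: power_weight_def power_weight_deriv_def power_mult_distrib field_simps)
  moreover have "0 \<le> ((1 + t\<^sup>2) powr (\<mu> / 2 - 1))\<^sup>2 / (\<mu> - 1)"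
    using assms by simp
  ultimately show ?thesis by linarith
qed

section \<open>The weighted energy estimate\<close>

text \<open>Expand the square of h g p + 2 A s, multiplied by a / (2 g). In the application h is the
  root of the cutoff, s a derivative of that root, A and g are G and G' at the first derivative of
  u, and p is a second derivative. The factor 1/2 lets the energy absorb the term.\<close>

lemma young_weighted:
  fixes a g :: real
  assumes "0 < g" "0 \<le> a" "A\<^sup>2 * a \<le> M * g"
  shows "- (2 * h * A * s * a * p) \<le> h\<^sup>2 * g * a * p\<^sup>2 / 2 + 2 * M * s\<^sup>2"
proof -
  have "0 \<le> a * (h * g * p + 2 * A * s)\<^sup>2 / (2 * g)"
    using assms by simp
  also have "\<dots> = h\<^sup>2 * g * a * p\<^sup>2 / 2 + 2 * h * A * s * a * p + 2 * s\<^sup>2 * (A\<^sup>2 * a / g)"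
    using assms(1) by (simp add: power2_eq_square field_simps)
  also have "2 * s\<^sup>2 * (A\<^sup>2 * a / g) \<le> 2 * s\<^sup>2 * M"
    using assms by (intro mult_left_mono) (auto simp: divide_le_eq)
  finally show ?thesis by (simp add: algebra_simps)
qed

lemma cutoff_gradient_square_le:
  fixes L x y :: real
  assumes "L \<noteq> 0"
  shows "(- (2 * x / (L * (1 + x\<^sup>2 + y\<^sup>2))))\<^sup>2 + (- (2 * y / (L * (1 + x\<^sup>2 + y\<^sup>2))))\<^sup>2
    \<le> 4 / L\<^sup>2 * (1 / (1 + x\<^sup>2 + y\<^sup>2))"
proof -
  let ?w = "1 + x\<^sup>2 + y\<^sup>2"
  have w: "0 < ?w" by (rule one_plus_squares_pos)
  have "(- (2 * x / (L * w)))\<^sup>2 + (- (2 * y / (L * w)))\<^sup>2 = 4 / L\<^sup>2 * ((x\<^sup>2 + y\<^sup>2) / w\<^sup>2)" for w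
    by (simp add: power_divide power_mult_distrib add_divide_distrib distrib_left)
  then have "(- (2 * x / (L * ?w)))\<^sup>2 + (- (2 * y / (L * ?w)))\<^sup>2 = 4 / L\<^sup>2 * ((x\<^sup>2 + y\<^sup>2) / ?w\<^sup>2)" .
  also have "\<dots> \<le> 4 / L\<^sup>2 * (?w / ?w\<^sup>2)"
    by (intro mult_left_mono divide_right_mono) auto
  also have "?w / ?w\<^sup>2 = 1 / ?w"
    using w by (simp add: power2_eq_square)
  finally show ?thesis .
qed

text \<open>Here p and q stand for the two first derivatives of u, r for the common mixed
  derivative, a and b for the second derivatives of the two summands of the integrand, and F for an
  antiderivative of b. Both coefficients must decay in terms of p alone, since the test function
  involves only G(p).\<close>

lemma second_derivatives_vanish:
  assumes \<mu>: "1 < \<mu>"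
    and p: "C1_plane p p1 r" and q: "C1_plane q r q2"
    and F: "\<And>t. (F has_real_derivative b t) (at t)"
    and a: "continuous_on UNIV a" "\<And>t. 0 < a t" and b: "continuous_on UNIV b" "\<And>t. 0 < b t"
    and eq: "\<And>z. a (p z) * p1 z + b (q z) * q2 z = 0"
    and Ka: "\<And>z. (1 + (p z)\<^sup>2) powr (\<mu> / 2) * a (p z) \<le> K"
    and Kb: "\<And>z. (1 + (p z)\<^sup>2) powr (\<mu> / 2) * b (q z) \<le> K"
  shows "p1 z = 0" "r z = 0" "q2 z = 0"
proof -
  define M where "M = K / (\<mu> - 1)"
  define g where "g z = power_weight_deriv \<mu> (p z)" for z
  define A where "A z = power_weight \<mu> (p z)" for z
  \<comment> \<open>This is the energy density without the cutoff. The goal is to show that it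
    vanishes; the factors G', a and b are positive, so the second derivatives then vanish
    too.\<close>
  define e where "e z = g z * (a (p z) * (p1 z)\<^sup>2 + b (q z) * (r z)\<^sup>2)" for z
  have g: "0 < g z" for z
    unfolding g_def by (rule power_weight_deriv_pos[OF \<mu>])
  have e: "0 \<le> e z" for z
    unfolding e_def using g[of z] a(2)[of "p z"] b(2)[of "q z"] by (simp add: less_imp_le)
  have weight: "(A z)\<^sup>2 * c \<le> M * g z" if "(1 + (p z)\<^sup>2) powr (\<mu> / 2) * c \<le> K" "0 < c" for c z
  proof -
    have "(A z)\<^sup>2 * c \<le> (1 + (p z)\<^sup>2) powr (\<mu> / 2) * g z / (\<mu> - 1) * c"
      using power_weight_square_le[OF \<mu>, of "p z"] that(2)
      unfolding A_def g_def by (intro mult_right_mono) auto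
    also have "\<dots> = ((1 + (p z)\<^sup>2) powr (\<mu> / 2) * c) * (g z / (\<mu> - 1))"
      by simp
    also have "\<dots> \<le> K * (g z / (\<mu> - 1))"
      using that(1) g[of z] \<mu> by (intro mult_right_mono) auto
    finally show ?thesis by (simp add: M_def)
  qed
  have A: "C1_plane A (\<lambda>z. g z * p1 z) (\<lambda>z. g z * r z)"
    unfolding A_def g_def
    by (rule C1_plane_compose[OF has_real_derivative_power_weight continuous_on_power_weight_deriv p])
  have B: "C1_plane (\<lambda>z. F (q z)) (\<lambda>z. b (q z) * r z) (\<lambda>z. b (q z) * q2 z)"
    by (rule C1_plane_compose[OF F b(1) q])
  have cont_e: "continuous_on X e" for X
  proof -
    have "continuous_on UNIV e"
      unfolding e_def[abs_def] g_def
      by (intro continuous_intros C1_planeD[OF p] C1_planeD[OF q]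
          continuous_on_compose2[OF a(1)] continuous_on_compose2[OF b(1)]
          continuous_on_compose2[OF continuous_on_power_weight_deriv]) auto
    then show ?thesis by (rule continuous_on_subset) simp
  qed
  \<comment> \<open>The constant 32 \<pi> M is the product of 16 M, from the pointwise estimate, and
    2 \<pi>, from the integral of 1 / (1 + |z|^2). The half-side exp L + 1 leaves the margin 1
    around the support required by the wedge identity.\<close>
  have energy: "integral (cbox (-(exp L + 1), -(exp L + 1)) (exp L + 1, exp L + 1))
      (\<lambda>z. (max 0 (cutoff_root L z))\<^sup>2 * e z) \<le> 32 * pi * M * (arsinh (exp L + 1) / L\<^sup>2)"
    if L: "0 < L" for L
  proof -
    let ?S = "exp L + 1"
    let ?Q = "cbox (-?S, -?S) (?S, ?S) :: (real \<times> real) set"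
    define h where "h z = max 0 (cutoff_root L z)" for z
    define s1 where "s1 z = - (2 * fst z / (L * (1 + (fst z)\<^sup>2 + (snd z)\<^sup>2)))" for z :: "real \<times> real"
    define s2 where "s2 z = - (2 * snd z / (L * (1 + (fst z)\<^sup>2 + (snd z)\<^sup>2)))" for z :: "real \<times> real"
    define k where "k z = 1 / (1 + (fst z)\<^sup>2 + (snd z)\<^sup>2)" for z :: "real \<times> real"
    have h: "C1_plane (\<lambda>z. (h z)\<^sup>2) (\<lambda>z. 2 * h z * s1 z) (\<lambda>z. 2 * h z * s2 z)"
      unfolding h_def s1_def s2_def using L by (intro C1_plane_cutoff) simp
    \<comment> \<open>D is the coefficient of the wedge product of the differentials of h^2 G(p) and
      F(q), so its integral vanishes without any second derivative of p or q.\<close>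
    define D where "D z = (2 * h z * s1 z * A z + (h z)\<^sup>2 * (g z * p1 z)) * (b (q z) * q2 z)
        - (2 * h z * s2 z * A z + (h z)\<^sup>2 * (g z * r z)) * (b (q z) * r z)" for z
    note hA = C1_plane_mult[OF h A]
    have "integral ?Q D = 0"
      unfolding D_def
    proof (rule integral_wedge_vanishing[OF hA B])
      show "(h (x, y))\<^sup>2 * A (x, y) = 0" if "exp L \<le> \<bar>x\<bar> \<or> exp L \<le> \<bar>y\<bar>" for x y
        using cutoff_root_nonpos[OF L that] by (simp add: h_def)
    qed (auto simp: add_nonneg_nonneg)
    \<comment> \<open>Inserting the equation turns D into the negative of h^2 e plus two cross
      terms. By Young's inequality the cross terms are at most h^2 e / 2 plus a multiple of the
      squared gradient of the root; doubling gives the claim.\<close>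
    have le: "(h z)\<^sup>2 * e z \<le> 16 * M / L\<^sup>2 * k z - 2 * D z" for z
    proof -
      have bq: "b (q z) * q2 z = - (a (p z) * p1 z)"
        using eq[of z] by linarith
      have "D z = - ((h z)\<^sup>2 * e z) - 2 * h z * A z * s1 z * a (p z) * p1 z - 2 * h z * A z * s2 z * b (q z) * r z"
        unfolding D_def bq e_def by (simp add: algebra_simps power2_eq_square)
      moreover have "- (2 * h z * A z * s1 z * a (p z) * p1 z) \<le> (h z)\<^sup>2 * g z * a (p z) * (p1 z)\<^sup>2 / 2 + 2 * M * (s1 z)\<^sup>2"
        using g a(2) weight[OF Ka] by (intro young_weighted) (auto simp: less_imp_le)
      moreover have "- (2 * h z * A z * s2 z * b (q z) * r z) \<le> (h z)\<^sup>2 * g z * b (q z) * (r z)\<^sup>2 / 2 + 2 * M * (s2 z)\<^sup>2"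
        using g b(2) weight[OF Kb] by (intro young_weighted) (auto simp: less_imp_le)
      moreover have "(h z)\<^sup>2 * g z * a (p z) * (p1 z)\<^sup>2 / 2 + (h z)\<^sup>2 * g z * b (q z) * (r z)\<^sup>2 / 2 = (h z)\<^sup>2 * e z / 2"
        unfolding e_def by (simp add: algebra_simps add_divide_distrib)
      moreover have "2 * M * (s1 z)\<^sup>2 + 2 * M * (s2 z)\<^sup>2 \<le> 8 * M / L\<^sup>2 * k z"
      proof -
        have "0 \<le> (1 + (p z)\<^sup>2) powr (\<mu> / 2) * a (p z)"
          using a(2)[of "p z"] by simp
        then have "0 \<le> M" using Ka[of z] \<mu> unfolding M_def by simp
        moreover have "(s1 z)\<^sup>2 + (s2 z)\<^sup>2 \<le> 4 / L\<^sup>2 * k z"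
          unfolding s1_def s2_def k_def using L by (intro cutoff_gradient_square_le) simp
        ultimately have "2 * M * ((s1 z)\<^sup>2 + (s2 z)\<^sup>2) \<le> 2 * M * (4 / L\<^sup>2 * k z)"
          by (intro mult_left_mono) auto
        then show ?thesis by (simp add: algebra_simps)
      qed
      moreover have "16 * M / L\<^sup>2 * k z = 2 * (8 * M / L\<^sup>2 * k z)"
        by simp
      ultimately show ?thesis by linarith
    qed
    have cont_k: "continuous_on ?Q k"
      unfolding k_def[abs_def] using one_plus_squares_pos[THEN less_imp_neq, symmetric]
      by (auto intro!: continuous_intros)
    have cont_D: "continuous_on ?Q D"
      unfolding D_def[abs_def]
      by (intro continuous_on_diff continuous_on_mult[OF continuous_on_subset[OF C1_planeD(2)[OF hA]]]
          continuous_on_mult[OF continuous_on_subset[OF C1_planeD(3)[OF hA]]]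
          continuous_on_subset[OF C1_planeD(2)[OF B]] continuous_on_subset[OF C1_planeD(3)[OF B]]) auto
    have cont_he: "continuous_on ?Q (\<lambda>z. (h z)\<^sup>2 * e z)"
      by (intro continuous_on_mult cont_e continuous_on_subset[OF C1_planeD(1)[OF h]]) simp
    have "integral ?Q (\<lambda>z. (h z)\<^sup>2 * e z) \<le> integral ?Q (\<lambda>z. 16 * M / L\<^sup>2 * k z - 2 * D z)"
      by (intro integral_le integrable_continuous cont_he continuous_intros cont_k cont_D le)
    also have "\<dots> = 16 * M / L\<^sup>2 * integral ?Q k - 2 * integral ?Q D"
      by (subst integral_diff[OF integrable_continuous[OF continuous_on_mult_left[OF cont_k]]
            integrable_continuous[OF continuous_on_mult_left[OF cont_D]]]) simp
    also have "\<dots> = 16 * M / L\<^sup>2 * integral ?Q k"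
      using \<open>integral ?Q D = 0\<close> by simp
    also have "\<dots> \<le> 16 * M / L\<^sup>2 * (2 * pi * arsinh ?S)"
    proof (rule mult_left_mono)
      show "integral ?Q k \<le> 2 * pi * arsinh ?S"
        unfolding k_def[abs_def]
        by (rule integral_inverse_one_plus_squares_le) (simp add: add_nonneg_nonneg)
      have "0 \<le> (1 + (p z)\<^sup>2) powr (\<mu> / 2) * a (p z)"
        using a(2)[of "p z"] by simp
      then have "0 \<le> M" using Ka[of z] \<mu> unfolding M_def by simp
      then show "0 \<le> 16 * M / L\<^sup>2" by simp
    qed
    finally show ?thesis unfolding h_def by (simp add: algebra_simps)
  qed
  have vanish: "e z = 0" for z
  proof -
    define n where "n = \<bar>fst z\<bar> + \<bar>snd z\<bar> + 1"
    let ?N = "cbox (-n, -n) (n, n) :: (real \<times> real) set"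
    have n: "1 \<le> n" "z \<in> ?N"
      unfolding n_def by (auto simp: cbox_Pair_eq mem_Times_iff)
    have "\<forall>\<^sub>F L in at_top. integral ?N e \<le> 128 * pi * M * (arsinh (exp L + 1) / L\<^sup>2)"
      \<comment> \<open>For such L the logarithm in the root is at most L / 2 on the fixed square,
        so the cutoff is at least 1/4 there. This costs a factor 4, whence 128 instead of 32. The
        same choice makes exp L at least n, so the fixed square lies in the large one.\<close>
      using eventually_ge_at_top[of "2 * ln (1 + 2 * n\<^sup>2)"] eventually_gt_at_top[of 0]
    proof eventually_elim
      case (elim L)
      let ?S = "exp L + 1"
      let ?Q = "cbox (-?S, -?S) (?S, ?S) :: (real \<times> real) set"
      let ?h = "\<lambda>z. (max 0 (cutoff_root L z))\<^sup>2"
      have pos: "0 < 1 + 2 * n\<^sup>2" by (simp add: add_pos_nonneg)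
      have "n \<le> 1 + 2 * n\<^sup>2"
        using self_le_power[OF n(1) pos2] zero_le_power2[of n] by linarith
      also have "\<dots> \<le> exp L"
      proof -
        have "0 \<le> ln (1 + 2 * n\<^sup>2)" by simp
        then have "ln (1 + 2 * n\<^sup>2) \<le> L" using elim(1) by linarith
        then show ?thesis using pos exp_le_cancel_iff[of "ln (1 + 2 * n\<^sup>2)" L] by simp
      qed
      finally have sub: "?N \<subseteq> ?Q"
        by (auto simp: cbox_Pair_eq)
      have cont_he: "continuous_on X (\<lambda>z. ?h z * e z)" for X
        using elim(2) 
        by (intro continuous_on_mult cont_e continuous_on_subset[OF C1_planeD(1)[OF C1_plane_cutoff]]) auto
      have quarter: "e w \<le> 4 * (?h w * e w)" if w: "w \<in> ?N" for w
      proof -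
        have "\<bar>fst w\<bar> \<le> n" "\<bar>snd w\<bar> \<le> n"
          using w by (auto simp: cbox_Pair_eq mem_Times_iff)
        then have "(fst w)\<^sup>2 \<le> n\<^sup>2" "(snd w)\<^sup>2 \<le> n\<^sup>2"
          by (auto simp: abs_le_square_iff[symmetric])
        then have "ln (1 + (fst w)\<^sup>2 + (snd w)\<^sup>2) \<le> ln (1 + 2 * n\<^sup>2)"
          using one_plus_squares_pos[of "fst w" "snd w"] pos by (subst ln_le_cancel_iff) linarith+
        then have "ln (1 + (fst w)\<^sup>2 + (snd w)\<^sup>2) / L \<le> 1 / 2"
          using elim by (simp add: field_simps)
        then have "1 / 2 \<le> max 0 (cutoff_root L w)"
          unfolding cutoff_root_def by linarith
        then have "(1 / 2)\<^sup>2 \<le> ?h w"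
          by (rule power_mono) simp
        then have "1 * e w \<le> (4 * ?h w) * e w"
          using e by (intro mult_right_mono) (auto simp: power2_eq_square)
        then show ?thesis by simp
      qed
      have "integral ?N e \<le> integral ?N (\<lambda>z. 4 * (?h z * e z))"
        by (intro integral_le integrable_continuous cont_e continuous_on_mult_left cont_he quarter)
      also have "\<dots> = 4 * integral ?N (\<lambda>z. ?h z * e z)"
        by simp
      also have "\<dots> \<le> 4 * integral ?Q (\<lambda>z. ?h z * e z)"
        by (intro mult_left_mono integral_subset_le sub integrable_continuous cont_he) (auto simp: e)
      also have "\<dots> \<le> 4 * (32 * pi * M * (arsinh ?S / L\<^sup>2))"
        using energy[OF elim(2)] by (intro mult_left_mono) auto
      finally show ?case by simp
    qed
    moreover have "((\<lambda>L. 128 * pi * M * (arsinh (exp L + 1) / L\<^sup>2)) \<longlongrightarrow> 128 * pi * M * 0) at_top"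
      by (rule tendsto_mult_left[OF tendsto_arsinh_exp_over_square])
    ultimately have "integral ?N e \<le> 0"
      using tendsto_lowerbound by fastforce
    moreover have "0 \<le> integral ?N e"
      by (intro integral_nonneg integrable_continuous cont_e e)
    ultimately have "integral ?N e = 0" by linarith
    \<comment> \<open>On a square with nonempty interior, a continuous nonnegative function with
      zero integral vanishes everywhere.\<close>
    moreover have "box (-n, -n) (n, n) \<noteq> ({} :: (real \<times> real) set)"
      using n(1) by (auto simp: box_ne_empty Basis_prod_def)
    ultimately show ?thesis
      using integral_cbox_eq_0_iff[OF cont_e, of "(-n, -n)" "(n, n)"] e n(2) by auto
  qed
  have "a (p z) * (p1 z)\<^sup>2 + b (q z) * (r z)\<^sup>2 = 0"
    using vanish[of z] g[of z] by (simp add: e_def)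
  moreover have "0 \<le> a (p z) * (p1 z)\<^sup>2" "0 \<le> b (q z) * (r z)\<^sup>2"
    using a(2) b(2) by (auto simp: less_imp_le)
  ultimately have "a (p z) * (p1 z)\<^sup>2 = 0" "b (q z) * (r z)\<^sup>2 = 0"
    by linarith+
  then show p1: "p1 z = 0" and "r z = 0"
    using a(2)[of "p z"] b(2)[of "q z"] by auto
  show "q2 z = 0"
    using eq[of z] p1 b(2)[of "q z"] by simp
qed

section \<open>From a growth relation for the gradient to bounds on the coefficients\<close>

text \<open>Comparing the bases leaves 1 + t^2 to the power (\<mu> - \<nu>) / 2, which is at most 1
  because the base is at least 1 and the exponent is not positive. The case s = t, N = 1 serves the
  coefficient a, the general case the coefficient b.\<close>

lemma powr_weight_bound:
  fixes s t b C N \<mu> \<nu> :: real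
  assumes "1 + s\<^sup>2 \<le> N * (1 + t\<^sup>2)" "0 \<le> N" "0 \<le> \<mu>" "\<mu> \<le> \<nu>" "0 \<le> C"
    and b: "b \<le> C * (1 + t\<^sup>2) powr (- \<nu> / 2)"
  shows "(1 + s\<^sup>2) powr (\<mu> / 2) * b \<le> C * N powr (\<mu> / 2)"
proof -
  have t: "0 < 1 + t\<^sup>2" "1 \<le> 1 + t\<^sup>2"
    using one_plus_square_pos by auto
  have "(1 + s\<^sup>2) powr (\<mu> / 2) * b \<le> (1 + s\<^sup>2) powr (\<mu> / 2) * (C * (1 + t\<^sup>2) powr (- \<nu> / 2))"
    by (rule mult_left_mono[OF b]) simp
  also have "\<dots> \<le> (N * (1 + t\<^sup>2)) powr (\<mu> / 2) * (C * (1 + t\<^sup>2) powr (- \<nu> / 2))"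
    using assms one_plus_square_pos[of s] by (intro mult_right_mono powr_mono2) auto
  also have "\<dots> = C * N powr (\<mu> / 2) * (1 + t\<^sup>2) powr (\<mu> / 2 + - \<nu> / 2)"
    using assms(2) t by (simp only: powr_mult powr_add mult_ac)
  also have "\<dots> \<le> C * N powr (\<mu> / 2) * 1"
    using assms t powr_mono[of "\<mu> / 2 + - \<nu> / 2" 0 "1 + t\<^sup>2"]
    by (intro mult_left_mono) (auto split: if_splits)
  finally show ?thesis by simp
qed

text \<open>The linear bound on p converts the decay of b in q into decay in p. The smaller of the
  two exponents then serves both coefficients and still exceeds 1.\<close>

lemma linearly_bounded_second_derivatives_vanish:
  assumes p: "C1_plane p p1 r" and q: "C1_plane q r q2"
    and F: "\<And>t. (F has_real_derivative b t) (at t)"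
    and a: "continuous_on UNIV a" "\<And>t. 0 < a t \<and> a t \<le> C1 * (1 + t\<^sup>2) powr (- \<mu>1 / 2)"
    and b: "continuous_on UNIV b" "\<And>t. 0 < b t \<and> b t \<le> C2 * (1 + t\<^sup>2) powr (- \<mu>2 / 2)"
    and \<mu>: "1 < \<mu>1" "1 < \<mu>2" and C: "0 < C1" "0 < C2"
    and eq: "\<And>z. a (p z) * p1 z + b (q z) * q2 z = 0"
    and bound: "\<And>z. \<bar>p z\<bar> \<le> C * (1 + \<bar>q z\<bar>)"
  shows "p1 z = 0 \<and> r z = 0 \<and> q2 z = 0"
proof -
  define \<mu> where "\<mu> = min \<mu>1 \<mu>2"
  \<comment> \<open>Since (1 + |q|)^2 is at most 2 (1 + q^2), the bound on p gives p^2 at most 2 C^2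
    (1 + q^2); the summand 1 in N accounts for the 1 in 1 + p^2.\<close>
  define N where "N = 1 + 2 * C\<^sup>2"
  define K where "K = max C1 (C2 * N powr (\<mu> / 2))"
  have \<mu>': "1 < \<mu>" "\<mu> \<le> \<mu>1" "\<mu> \<le> \<mu>2"
    using \<mu> by (auto simp: \<mu>_def)
  have "(1 + (p z)\<^sup>2) powr (\<mu> / 2) * a (p z) \<le> C1 * 1 powr (\<mu> / 2)" for z
    using \<mu>' C a(2) by (intro powr_weight_bound[where \<nu> = \<mu>1]) auto
  then have Ka: "(1 + (p z)\<^sup>2) powr (\<mu> / 2) * a (p z) \<le> K" for z
    unfolding K_def by (simp add: le_max_iff_disj)
  have "(1 + (p z)\<^sup>2) powr (\<mu> / 2) * b (q z) \<le> C2 * N powr (\<mu> / 2)" for z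
  proof (rule powr_weight_bound)
    have "(p z)\<^sup>2 \<le> (C * (1 + \<bar>q z\<bar>))\<^sup>2"
      using power_mono[OF bound[of z], of 2] by simp
    also have "\<dots> \<le> C\<^sup>2 * (2 * (1 + (q z)\<^sup>2))"
    proof -
      have "(1 + \<bar>q z\<bar>)\<^sup>2 \<le> 2 * (1 + (q z)\<^sup>2)"
        using zero_le_power2[of "1 - \<bar>q z\<bar>"] by (simp add: power2_eq_square algebra_simps)
      then show ?thesis unfolding power_mult_distrib by (rule mult_left_mono) simp
    qed
    finally have "(p z)\<^sup>2 \<le> 2 * C\<^sup>2 * (1 + (q z)\<^sup>2)" by (simp add: algebra_simps)
    then show "1 + (p z)\<^sup>2 \<le> N * (1 + (q z)\<^sup>2)"
      unfolding N_def distrib_right mult_1 using zero_le_power2[of "q z"] by linarith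
    show "b (q z) \<le> C2 * (1 + (q z)\<^sup>2) powr (- \<mu>2 / 2)"
      using b(2) by simp
  qed (use \<mu>' C N_def in auto)
  then have Kb: "(1 + (p z)\<^sup>2) powr (\<mu> / 2) * b (q z) \<le> K" for z
    unfolding K_def by (simp add: le_max_iff_disj)
  show ?thesis
    using second_derivatives_vanish[OF \<mu>'(1) p q F a(1) _ b(1) _ eq Ka Kb] a(2) b(2) by blast
qed

section \<open>Affine functions and the passage from vectors to pairs\<close>

lemma C1_plane_constant_gradient:
  assumes "C1_plane f (\<lambda>_. a) (\<lambda>_. b)"
  shows "f (x, y) = a * x + b * y + f (0, 0)"
proof -
  have "((\<lambda>s. f (s, y) - a * s) has_real_derivative 0) (at s)" for s
    using C1_planeD(4)[OF assms] by (auto intro!: derivative_eq_intros)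
  then have 1: "f (x, y) - a * x = f (0, y) - a * 0"
    using DERIV_isconst_all by blast
  have "((\<lambda>t. f (0, t) - b * t) has_real_derivative 0) (at t)" for t
    using C1_planeD(5)[OF assms] by (auto intro!: derivative_eq_intros)
  then have "f (0, y) - b * y = f (0, 0) - b * 0"
    using DERIV_isconst_all by blast
  with 1 show ?thesis by simp
qed

lemma has_real_derivative_partial_deriv:
  assumes "v differentiable (at x)"
  shows "((\<lambda>t. v (x + t *\<^sub>R axis i 1)) has_real_derivative partial_deriv i v x) (at 0)"
proof -
  have "(v \<circ> (\<lambda>t. x + t *\<^sub>R axis i 1)) differentiable (at (0::real))"
    by (rule differentiable_chain_at) (use assms in \<open>auto intro!: derivative_intros\<close>)
  then have "(\<lambda>t. v (x + t *\<^sub>R axis i 1)) differentiable (at 0)"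
    by (simp add: o_def)
  then show ?thesis
    unfolding partial_deriv_def by (simp add: DERIV_deriv_iff_real_differentiable)
qed

definition plane_point :: "real \<times> real \<Rightarrow> real ^ 2"
  where "plane_point z = fst z *\<^sub>R axis 1 1 + snd z *\<^sub>R axis 2 1"

lemma plane_point_coordinates: "plane_point (x $ 1, x $ 2) = x"
  by (simp add: plane_point_def vec_eq_iff forall_2 axis_def)

text \<open>\<open>partial_deriv\<close> differentiates at 0 along a line through the point, whereas
  \<open>C1_plane\<close> differentiates at the actual coordinate; a shift of the line parameter
  identifies the two.\<close>

lemma C1_space_imp_C1_plane:
  assumes v: "C1_space v"
  shows "C1_plane (\<lambda>z. v (plane_point z)) (\<lambda>z. partial_deriv 1 v (plane_point z))
    (\<lambda>z. partial_deriv 2 v (plane_point z))"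
proof -
  have diff: "v differentiable (at x)" for x
    using v by (simp add: C1_space_def)
  have pt: "continuous_on UNIV plane_point"
    unfolding plane_point_def[abs_def] by (intro continuous_intros)
  have line: "((\<lambda>s. v (x + (s - c) *\<^sub>R axis i 1)) has_real_derivative partial_deriv i v x) (at c)" for x c i
    using DERIV_shift[of "\<lambda>s. v (x + (s - c) *\<^sub>R axis i 1)" "partial_deriv i v x" 0 c]
      has_real_derivative_partial_deriv[OF diff, of x i] by simp
  have 1: "plane_point (x, y) + (s - x) *\<^sub>R axis 1 1 = plane_point (s, y)" for x y s
    by (simp add: plane_point_def algebra_simps)
  have 2: "plane_point (x, y) + (s - y) *\<^sub>R axis 2 1 = plane_point (x, s)" for x y s
    by (simp add: plane_point_def algebra_simps)
  have "continuous_on UNIV v"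
    using diff by (simp add: continuous_at_imp_continuous_on differentiable_imp_continuous_within)
  then show ?thesis
    using v line[of "plane_point (x, y)" x 1 for x y] line[of "plane_point (x, y)" y 2 for x y]
    unfolding C1_plane_def C1_space_def 1 2
    by (auto intro: continuous_on_compose2[OF _ pt])
qed

lemma C2_lineD:
  assumes "C2_line f"
  shows "(f has_real_derivative deriv f t) (at t)"
    and "(deriv f has_real_derivative deriv (deriv f) t) (at t)"
    and "continuous_on UNIV (deriv (deriv f))"
proof -
  have C1: "(\<forall>t. (g has_real_derivative deriv g t) (at t)) \<and> continuous_on UNIV (deriv g)"
    if "g C1_differentiable_on UNIV" for g :: "real \<Rightarrow> real"
  proof -
    obtain D where D: "\<And>t. (g has_real_derivative D t) (at t)" "continuous_on UNIV D"
      using \<open>g C1_differentiable_on UNIV\<close>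
      by (auto simp: C1_differentiable_on_def has_real_derivative_iff_has_vector_derivative)
    moreover have "deriv g = D" using D(1) DERIV_imp_deriv by blast
    ultimately show ?thesis by simp
  qed
  show "(f has_real_derivative deriv f t) (at t)"
    "(deriv f has_real_derivative deriv (deriv f) t) (at t)"
    "continuous_on UNIV (deriv (deriv f))"
    using assms C1 unfolding C2_line_def by blast+
qed

text \<open>A finite upper limit bounds the quotient outside some ball, and compactness bounds the
  continuous quotient on the ball. This makes the asymptotic condition a global inequality, as the
  energy estimate needs.\<close>

lemma Limsup_ratio_finite_imp_bounded:
  fixes p q :: "real ^ 'n \<Rightarrow> real"
  assumes "continuous_on UNIV p" "continuous_on UNIV q"
    and "Limsup at_infinity (\<lambda>x. ereal (\<bar>p x\<bar> / (1 + \<bar>q x\<bar>))) \<noteq> \<infinity>"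
  obtains C where "\<And>x. \<bar>p x\<bar> \<le> C * (1 + \<bar>q x\<bar>)"
proof -
  let ?g = "\<lambda>x. \<bar>p x\<bar> / (1 + \<bar>q x\<bar>)"
  obtain n :: nat where "Limsup at_infinity (\<lambda>x. ereal (?g x)) < ereal (real n)"
    using assms(3) less_PInf_Ex_of_nat by auto
  then have "\<forall>\<^sub>F x in at_infinity. ereal (?g x) < ereal (real n)"
    by (rule Limsup_lessD)
  then obtain R where R: "\<And>x. R \<le> norm x \<Longrightarrow> ?g x < real n"
    by (auto simp: eventually_at_infinity)
  have "1 + \<bar>q x\<bar> \<noteq> 0" for x by linarith
  then have "continuous_on (cball 0 R) ?g"
    by (intro continuous_intros continuous_on_subset[OF assms(1)] continuous_on_subset[OF assms(2)]) auto
  then have "bounded (?g ` cball 0 R)"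
    by (intro compact_imp_bounded compact_continuous_image) auto
  then obtain B where B: "\<And>x. x \<in> cball 0 R \<Longrightarrow> ?g x \<le> B"
    unfolding bounded_iff by fastforce
  have "?g x \<le> max (real n) B" for x
    using R[of x] B[of x] by (cases "R \<le> norm x") (auto simp: le_max_iff_disj)
  then have "\<bar>p x\<bar> \<le> max (real n) B * (1 + \<bar>q x\<bar>)" for x
    by (simp add: divide_le_eq add_pos_nonneg)
  then show ?thesis using that by blast
qed

section \<open>Solutions that are not unbalanced are affine\<close>

theorem theorem1p4:
  fixes f1 f2 :: "real \<Rightarrow> real"
    and f u :: "real ^ 2 \<Rightarrow> real"
    and C1 C2 \<mu>1 \<mu>2 :: real
  assumes "C2_line f1" and "C2_line f2"
    and "C1 > 0" and "C2 > 0" and "\<mu>1 > 1" and "\<mu>2 > 1"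
    and "\<And>t. 0 < deriv (deriv f1) t \<and> deriv (deriv f1) t \<le> C1 * (1 + t\<^sup>2) powr (- \<mu>1 / 2)"
    and "\<And>t. 0 < deriv (deriv f2) t \<and> deriv (deriv f2) t \<le> C2 * (1 + t\<^sup>2) powr (- \<mu>2 / 2)"
    and "\<And>p. f p = f1 (p $ 1) + f2 (p $ 2)"
    and "C2_space u"
    and "\<And>x. divergence (\<lambda>y. gradient f (gradient u y)) x = 0"
  shows "affine_function u \<or> unbalanced u"
proof (rule disjCI)
  assume not_unbalanced: "\<not> unbalanced u"
  note f1 = C2_lineD[OF assms(1)] and f2 = C2_lineD[OF assms(2)]
  define pu where "pu i = partial_deriv i u" for i :: 2
  have u: "C1_space u" and pu: "C1_space (pu i)" for i
    using assms(10) by (auto simp: C2_space_def pu_def)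
  define p where "p z = pu 1 (plane_point z)" for z
  define q where "q z = pu 2 (plane_point z)" for z
  define p1 where "p1 z = partial_deriv 1 (pu 1) (plane_point z)" for z
  define p2 where "p2 z = partial_deriv 2 (pu 1) (plane_point z)" for z
  define q1 where "q1 z = partial_deriv 1 (pu 2) (plane_point z)" for z
  define q2 where "q2 z = partial_deriv 2 (pu 2) (plane_point z)" for z
  have U: "C1_plane (\<lambda>z. u (plane_point z)) p q"
    using C1_space_imp_C1_plane[OF u] by (simp add: p_def[abs_def] q_def[abs_def] pu_def)
  have P: "C1_plane p p1 p2" and Q0: "C1_plane q q1 q2"
    using C1_space_imp_C1_plane[OF pu]
    by (simp_all add: p_def[abs_def] q_def[abs_def] p1_def[abs_def] p2_def[abs_def] q1_def[abs_def] q2_def[abs_def])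
  \<comment> \<open>Equality of the mixed derivatives lets p and q share the function called r in
    the energy estimate.\<close>
  have Q: "C1_plane q p2 q2"
    using Q0 mixed_partials_commute[OF U P Q0] by simp
  have grad_f: "gradient f v $ 1 = deriv f1 (v $ 1)" "gradient f v $ 2 = deriv f2 (v $ 2)" for v
  proof -
    have "((\<lambda>t. f1 (v $ 1 + t) + f2 (v $ 2)) has_real_derivative deriv f1 (v $ 1)) (at 0)"
      using DERIV_shift[of f1 "deriv f1 (v $ 1)" 0 "v $ 1"] f1(1)[of "v $ 1"]
      by (auto intro!: derivative_eq_intros simp: add.commute)
    then show "gradient f v $ 1 = deriv f1 (v $ 1)"
      by (simp add: gradient_def partial_deriv_def assms(9) axis_def DERIV_imp_deriv)
    have "((\<lambda>t. f1 (v $ 1) + f2 (v $ 2 + t)) has_real_derivative deriv f2 (v $ 2)) (at 0)"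
      using DERIV_shift[of f2 "deriv f2 (v $ 2)" 0 "v $ 2"] f2(1)[of "v $ 2"]
      by (auto intro!: derivative_eq_intros simp: add.commute)
    then show "gradient f v $ 2 = deriv f2 (v $ 2)"
      by (simp add: gradient_def partial_deriv_def assms(9) axis_def DERIV_imp_deriv)
  qed
  \<comment> \<open>With the integrand split into functions of one variable, each summand of the
    divergence differentiates a function of a single component of the gradient.\<close>
  have chain: "partial_deriv i (\<lambda>y. g (pu i y)) x = g' (pu i x) * partial_deriv i (pu i) x"
    if g: "\<And>t. (g has_real_derivative g' t) (at t)" for g g' i x
  proof -
    have "((\<lambda>t. pu i (x + t *\<^sub>R axis i 1)) has_real_derivative partial_deriv i (pu i) x) (at 0)"
      using pu by (intro has_real_derivative_partial_deriv) (simp add: C1_space_def)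
    then have "((\<lambda>t. g (pu i (x + t *\<^sub>R axis i 1))) has_real_derivative
        g' (pu i x) * partial_deriv i (pu i) x) (at 0)"
      using DERIV_chain2[where f = g and x = 0] g by fastforce
    then show ?thesis unfolding partial_deriv_def by (rule DERIV_imp_deriv)
  qed
  have eq: "deriv (deriv f1) (p z) * p1 z + deriv (deriv f2) (q z) * q2 z = 0" for z
  proof -
    have grad_u: "gradient u y $ i = pu i y" for y i
      by (simp add: gradient_def pu_def)
    have "divergence (\<lambda>y. gradient f (gradient u y)) (plane_point z) =
      partial_deriv 1 (\<lambda>y. deriv f1 (pu 1 y)) (plane_point z) + partial_deriv 2 (\<lambda>y. deriv f2 (pu 2 y)) (plane_point z)"
      by (simp add: divergence_def sum_2 grad_f grad_u)
    then show ?thesis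
      using assms(11)[of "plane_point z"] chain[OF f1(2), of 1] chain[OF f2(2), of 2]
      by (simp add: p_def q_def p1_def q2_def)
  qed
  have cont: "continuous_on UNIV (pu i)" for i
    using u by (simp add: C1_space_def pu_def)
  have vanish: "p1 z = 0 \<and> p2 z = 0 \<and> q2 z = 0" for z
  proof (cases "Limsup at_infinity (\<lambda>x. ereal (\<bar>pu 1 x\<bar> / (1 + \<bar>pu 2 x\<bar>))) = \<infinity>")
    case False
    then obtain C where "\<And>x. \<bar>pu 1 x\<bar> \<le> C * (1 + \<bar>pu 2 x\<bar>)"
      using Limsup_ratio_finite_imp_bounded[OF cont cont] by blast
    then have "\<bar>p z\<bar> \<le> C * (1 + \<bar>q z\<bar>)" for z
      by (simp add: p_def q_def)
    then show ?thesis
      by (rule linearly_bounded_second_derivatives_vanish[OF P Q f2(2) f1(3) assms(7) f2(3) assms(8,5,6,3,4) eq])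
  next
    case True
    then have "Limsup at_infinity (\<lambda>x. ereal (\<bar>pu 2 x\<bar> / (1 + \<bar>pu 1 x\<bar>))) \<noteq> \<infinity>"
      using not_unbalanced u by (simp add: unbalanced_def pu_def)
    then obtain C where "\<And>x. \<bar>pu 2 x\<bar> \<le> C * (1 + \<bar>pu 1 x\<bar>)"
      using Limsup_ratio_finite_imp_bounded[OF cont cont] by blast
    then have bound: "\<bar>q (snd z, fst z)\<bar> \<le> C * (1 + \<bar>p (snd z, fst z)\<bar>)" for z
      by (simp add: p_def q_def)
    \<comment> \<open>The lemma bounds the first derivative in the first variable by the other one.
      Exchanging the coordinates, and with them the roles of p and q and of the two coefficients,
      reduces this case to the previous one.\<close>
    have eq': "deriv (deriv f2) (q (snd z, fst z)) * q2 (snd z, fst z)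
        + deriv (deriv f1) (p (snd z, fst z)) * p1 (snd z, fst z) = 0" for z
      using eq[of "(snd z, fst z)"] by linarith
    show ?thesis
      using linearly_bounded_second_derivatives_vanish[OF C1_plane_swap[OF Q] C1_plane_swap[OF P]
          f1(2) f2(3) assms(8) f1(3) assms(7,6,5,4,3) eq' bound, of "(snd z, fst z)"]
      by simp
  qed
  \<comment> \<open>Both components of the gradient have zero gradient and are therefore constant;
    applied once more, the same lemma makes u affine.\<close>
  have "p z = p (0, 0)" "q z = q (0, 0)" for z
  proof -
    have "C1_plane p (\<lambda>_. 0) (\<lambda>_. 0)" "C1_plane q (\<lambda>_. 0) (\<lambda>_. 0)"
      using P Q vanish by (simp_all add: C1_plane_def)
    then show "p z = p (0, 0)" "q z = q (0, 0)"
      using C1_plane_constant_gradient[of _ 0 0 "fst z" "snd z"] by simp_all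
  qed
  then have "p = (\<lambda>_. p (0, 0))" "q = (\<lambda>_. q (0, 0))"
    by blast+
  then have "C1_plane (\<lambda>z. u (plane_point z)) (\<lambda>_. p (0, 0)) (\<lambda>_. q (0, 0))"
    using U by simp
  note affine = C1_plane_constant_gradient[OF this]
  have "u x = (p (0, 0) *\<^sub>R axis 1 1 + q (0, 0) *\<^sub>R axis 2 1) \<bullet> x + u (plane_point (0, 0))" for x
    using affine[of "x $ 1" "x $ 2"]
    by (simp add: plane_point_coordinates inner_add_left inner_axis')
  then show "affine_function u"
    unfolding affine_function_def by blast
qed

end
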